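(* Let $a,b$ be axes in $A$. If $(a,b)\ne\frac14$, then $b_{1/2}(x_0y_0)=(b_{1/2}x_0)y_0+(b_{1/2}y_0)x_0$ for all $x_0,y_0\in A_0(a)$.
   Context: $\mathbb{F}$ is a field of characteristic not $2$ and $A$ is a commutative, not necessarily associative, $\mathbb{F}$-algebra equipped with a Frobenius form, i.e. a symmetric bilinear form $(\cdot,\cdot):A\times A\to\mathbb{F}$ with $(xy,z)=(x,yz)$ for all $x,y,z\in A$. For $z\in A$ and $\lambda\in\mathbb{F}$ put $A_\lambda(z)=\{x\in A: zx=\lambda x\}$. An axis is an idempotent $c\in A$ (so $c^2=c$) such that $(c,c)=1$, $A=\mathbb{F}c\oplus A_0(c)\oplus A_{1/2}(c)$, and the fusion rules hold: for $x_0,y_0\in A_0(c)$ and $x_{1/2},y_{1/2}\in A_{1/2}(c)$ one has $x_0y_0\in A_0(c)$, $x_0y_{1/2}\in A_{1/2}(c)$, $x_{1/2}y_{1/2}\in\mathbb{F}c+A_0(c)$. Given the axis $a$, each $x\in A$ is written uniquely $x=(a,x)a+x_0+x_{1/2}$ with $x_\lambda\in A_\lambda(a)$, $\lambda\in\{0,\frac12\}$. In particular $b=(a,b)a+b_0+b_{1/2}$. *)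

theory Defs
  imports Complex_Main
begin

text \<open>The algebra is the whole type \<open>'a\<close>. It is neither assumed associative nor unital,
  and may have any dimension.\<close>

locale frobenius_algebra = vector_space scale
  for scale :: "'f::field \<Rightarrow> 'a::ab_group_add \<Rightarrow> 'a" (infixr "*s" 75) +
  fixes mult :: "'a \<Rightarrow> 'a \<Rightarrow> 'a" (infixl "\<cdot>" 70)
    and form :: "'a \<Rightarrow> 'a \<Rightarrow> 'f"
  assumes char_not_2: "CHAR('f) \<noteq> 2"
    and mult_linear_left: "Vector_Spaces.linear scale scale (\<lambda>x. x \<cdot> y)"
    and mult_linear_right: "Vector_Spaces.linear scale scale (\<lambda>y. x \<cdot> y)"
    and mult_commute: "x \<cdot> y = y \<cdot> x"
    and form_linear_left: "Vector_Spaces.linear scale (*) (\<lambda>x. form x y)"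
    and form_linear_right: "Vector_Spaces.linear scale (*) (\<lambda>y. form x y)"
    and form_commute: "form x y = form y x"
    and form_assoc: "form (x \<cdot> y) z = form x (y \<cdot> z)"
begin

definition eigenspace :: "'a \<Rightarrow> 'f \<Rightarrow> 'a set" where
  "eigenspace z l = {x. z \<cdot> x = l *s x}"

text \<open>The third conjunct is the direct sum decomposition
  \<open>A = \<F>c \<oplus> A\<^sub>0(c) \<oplus> A\<^sub>1\<^sub>/\<^sub>2(c)\<close>; the last three are the fusion rules.\<close>

definition axis :: "'a \<Rightarrow> bool" where
  "axis c \<longleftrightarrow>
    c \<cdot> c = c \<and>
    form c c = 1 \<and>
    (\<forall>x. \<exists>!(u, x0, xh). u \<in> span {c} \<and> x0 \<in> eigenspace c 0 \<and> xh \<in> eigenspace c (1/2) \<and>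
       x = u + x0 + xh) \<and>
    (\<forall>x0 \<in> eigenspace c 0. \<forall>y0 \<in> eigenspace c 0. x0 \<cdot> y0 \<in> eigenspace c 0) \<and>
    (\<forall>x0 \<in> eigenspace c 0. \<forall>yh \<in> eigenspace c (1/2). x0 \<cdot> yh \<in> eigenspace c (1/2)) \<and>
    (\<forall>xh \<in> eigenspace c (1/2). \<forall>yh \<in> eigenspace c (1/2).
       \<exists>u \<in> span {c}. \<exists>z0 \<in> eigenspace c 0. xh \<cdot> yh = u + z0)"

text \<open>The component \<open>x\<^sub>1\<^sub>/\<^sub>2\<close> in the decomposition
  \<open>x = (a,x)a + x\<^sub>0 + x\<^sub>1\<^sub>/\<^sub>2\<close>, which exists and is unique when \<open>a\<close> is an axis.\<close>

definition half_part :: "'a \<Rightarrow> 'a \<Rightarrow> 'a" where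
  "half_part a x = (THE xh. xh \<in> eigenspace a (1/2) \<and>
     (\<exists>x0 \<in> eigenspace a 0. x = form a x *s a + x0 + xh))"

end

end

theory Submission
  imports Defs
begin

text \<open>
  Write \<open>b = \<alpha>a + e + s\<close> with \<open>\<alpha> = (a,b)\<close>, \<open>e \<in> A\<^sub>0(a)\<close>, \<open>s \<in> A\<^sub>1\<^sub>/\<^sub>2(a)\<close>, and
  \<open>D = x(sy) + (sx)y - s(xy)\<close> for \<open>x, y \<in> A\<^sub>0(a)\<close>. The Miyamoto involution of \<open>b\<close> being
  multiplicative, the \<open>A\<^sub>1\<^sub>/\<^sub>2(a)\<close>-component of that identity on \<open>x, y\<close> reads
  \<open>4((ex)(sy) + (sx)(ey)) = D + (e,y)sx + (e,x)sy + (e,xy)s\<close>.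
  The image of \<open>a\<close> under the involution of \<open>b\<close> satisfies the same identities, with \<open>e, s\<close>
  replaced by \<open>4\<alpha>e, (4\<alpha>-2)s\<close>; comparing the two versions gives \<open>(4\<alpha>-2)(4\<alpha>-1)D = 0\<close>.

  If \<open>\<alpha> = 1/2\<close>, that image is \<open>2e\<close>, so \<open>4e(ez) = ez + 2(e,z)e\<close> for all \<open>z\<close>. On the other hand
  the identity for \<open>b\<close> on \<open>x, sy\<close> yields \<open>eD = -D/4\<close>; since \<open>(e,D) = 0\<close>, this forces \<open>D = 0\<close>.
\<close>

context frobenius_algebra
begin

section \<open>Linear functionals and bilinearity\<close>

text \<open>Functionals separate points, since a nonzero \<open>x - y\<close> extends to a basis.
  This turns identities between vectors into identities between field elements, which
  \<open>algebra\<close> can decide from the hypotheses.\<close>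

lemma eq_by_functionals:
  assumes "\<And>f. Vector_Spaces.linear scale (*) f \<Longrightarrow> f x = f y"
  shows "x = y"
proof (rule ccontr)
  assume "x \<noteq> y"
  then have "independent {x - y}" by simp
  interpret vector_space_pair scale "(*) :: 'f \<Rightarrow> 'f \<Rightarrow> 'f"
    by unfold_locales (auto simp: algebra_simps)
  obtain f where f: "Vector_Spaces.linear scale (*) f" "f (x - y) = 1"
    using linear_independent_extend[OF \<open>independent {x - y}\<close>, of "\<lambda>_. 1"] by auto
  then have "f x - f y = 1" by (metis linear_diff)
  with assms[OF f(1)] show False by simp
qed

lemma functional_simps:
  assumes "Vector_Spaces.linear scale (*) f"
  shows "f (x + y) = f x + f y" "f (x - y) = f x - f y" "f (- x) = - f x"
    "f (k *s x) = k * f x" "f 0 = (0 :: 'f)"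
proof -
  interpret f: Vector_Spaces.linear scale "(*)" f by fact
  show "f (x + y) = f x + f y" "f (x - y) = f x - f y" "f (- x) = - f x"
    "f (k *s x) = k * f x" "f 0 = (0 :: 'f)"
    by (simp_all add: f.add f.diff f.neg f.scale)
qed

lemmas form_simps = functional_simps[OF form_linear_left] functional_simps[OF form_linear_right]

lemma mult_simps:
  shows "(x + y) \<cdot> z = x \<cdot> z + y \<cdot> z" "(x - y) \<cdot> z = x \<cdot> z - y \<cdot> z" "(- x) \<cdot> z = - (x \<cdot> z)"
    "(k *s x) \<cdot> z = k *s (x \<cdot> z)" "0 \<cdot> z = 0"
    "z \<cdot> (x + y) = z \<cdot> x + z \<cdot> y" "z \<cdot> (x - y) = z \<cdot> x - z \<cdot> y" "z \<cdot> (- x) = - (z \<cdot> x)"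
    "z \<cdot> (k *s x) = k *s (z \<cdot> x)" "z \<cdot> 0 = 0"
proof -
  interpret l: Vector_Spaces.linear scale scale "\<lambda>x. x \<cdot> z" by (rule mult_linear_left)
  interpret r: Vector_Spaces.linear scale scale "\<lambda>x. z \<cdot> x" by (rule mult_linear_right)
  show "(x + y) \<cdot> z = x \<cdot> z + y \<cdot> z" "(x - y) \<cdot> z = x \<cdot> z - y \<cdot> z" "(- x) \<cdot> z = - (x \<cdot> z)"
    "(k *s x) \<cdot> z = k *s (x \<cdot> z)" "0 \<cdot> z = 0"
    "z \<cdot> (x + y) = z \<cdot> x + z \<cdot> y" "z \<cdot> (x - y) = z \<cdot> x - z \<cdot> y" "z \<cdot> (- x) = - (z \<cdot> x)"
    "z \<cdot> (k *s x) = k *s (z \<cdot> x)" "z \<cdot> 0 = 0"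
    by (simp_all add: l.add l.diff l.neg l.scale r.add r.diff r.neg r.scale)
qed

lemma two_neq_0: "(2 :: 'f) \<noteq> 0"
proof
  assume "(2 :: 'f) = 0"
  then have "CHAR('f) dvd 2" using of_nat_eq_0_iff_char_dvd[of 2, where 'a = 'f] by simp
  then have "CHAR('f) \<le> 2" "CHAR('f) \<noteq> 0" by (auto dest: dvd_imp_le intro: gr0I)
  moreover have "CHAR('f) \<noteq> 1" unfolding One_nat_def by (rule CHAR_not_1)
  ultimately show False using char_not_2 by linarith
qed

lemma two_neq_1: "(2 :: 'f) \<noteq> 1"
  by (metis add_cancel_right_right one_add_one zero_neq_one)

section \<open>Peirce decomposition with respect to an axis\<close>

text \<open>Associativity of the form together with commutativity makes multiplication by
  \<open>c\<close> self-adjoint.\<close>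

lemma orthogonal_eigenvectors:
  assumes "c \<cdot> x = k *s x" "c \<cdot> y = l *s y" "k \<noteq> l"
  shows "form x y = 0"
proof -
  have "form (c \<cdot> x) y = form x (c \<cdot> y)" by (metis form_assoc mult_commute)
  then have "(k - l) * form x y = 0" using assms by (simp add: form_simps algebra_simps)
  then show ?thesis using assms(3) by simp
qed

text \<open>The eigenvalues 0 and 1/2 differ from 1, so both eigenspaces are orthogonal to
  \<open>c\<close>; pairing the decomposition with \<open>c\<close> then identifies the coefficient
  of \<open>c\<close>.\<close>

lemma axis_decomp:
  assumes "axis c"
  obtains x0 xh where "c \<cdot> x0 = 0" "c \<cdot> xh = (1/2) *s xh" "x = form c x *s c + x0 + xh"
    "form c x0 = 0" "form c xh = 0"
proof -
  have cc: "c \<cdot> c = 1 *s c" "form c c = 1" using assms by (auto simp: axis_def)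
  obtain u x0 xh where *: "u \<in> span {c}" "x0 \<in> eigenspace c 0" "xh \<in> eigenspace c (1/2)"
      "x = u + x0 + xh"
    using assms unfolding axis_def by blast
  obtain k where u: "u = k *s c" using *(1) by (auto simp: span_singleton)
  have h: "(1::'f) \<noteq> 1/2" using two_neq_0 two_neq_1 by (auto simp: field_simps)
  have x0: "c \<cdot> x0 = 0 *s x0" and xh: "c \<cdot> xh = (1/2) *s xh"
    using * by (auto simp: eigenspace_def)
  have f: "form c x0 = 0" "form c xh = 0"
    using orthogonal_eigenvectors[OF cc(1) x0] orthogonal_eigenvectors[OF cc(1) xh] h by auto
  then have "form c x = k" using *(4) u cc(2) by (simp add: form_simps)
  then show thesis using that[OF _ xh _ f] *(4) u x0 by simp
qed

section \<open>Polynomial laws satisfied by an axis\<close>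

text \<open>\<open>tau_law c\<close> says that \<open>x \<mapsto> x - 4cx + 4(c,x)c\<close> is multiplicative, given \<open>sq_law c\<close>.\<close>

definition sq_law :: "'a \<Rightarrow> bool" where
  "sq_law c \<longleftrightarrow> (\<forall>x. 2 *s (c \<cdot> (c \<cdot> x)) = c \<cdot> x + form c x *s c)"

definition tau_law :: "'a \<Rightarrow> bool" where
  "tau_law c \<longleftrightarrow> (\<forall>x y. 4 *s ((c \<cdot> x) \<cdot> (c \<cdot> y)) + c \<cdot> (x \<cdot> y) =
     x \<cdot> (c \<cdot> y) + (c \<cdot> x) \<cdot> y + form c y *s (c \<cdot> x) + form c x *s (c \<cdot> y) + form c (x \<cdot> y) *s c)"

text \<open>Multiplication by \<open>c\<close> has eigenvalues 1, 0 and 1/2. The last two are the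
  roots of 2t^2 = t, and the form term corrects the discrepancy on the line of
  \<open>c\<close>.\<close>

lemma axis_sq_law:
  assumes "axis c"
  shows "sq_law c"
  unfolding sq_law_def
proof
  fix x
  obtain x0 xh where *: "c \<cdot> x0 = 0" "c \<cdot> xh = (1/2) *s xh" "x = form c x *s c + x0 + xh"
    using axis_decomp[OF assms] by metis
  have cc: "c \<cdot> c = c" using assms by (simp add: axis_def)
  \<comment> \<open>Here and below, 1/2 gets a name so that \<open>algebra\<close> can treat it as
    an indeterminate subject to \<open>2 * k = 1\<close>.\<close>
  define k :: 'f where "k = 1/2"
  have k: "2 * k = 1" using two_neq_0 by (simp add: k_def)
  have xh: "c \<cdot> xh = k *s xh" using *(2) by (simp add: k_def)
  have cx: "c \<cdot> x = form c x *s c + k *s xh"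
    by (subst *(3)) (simp add: mult_simps cc *(1,2) xh k_def)
  show "2 *s (c \<cdot> (c \<cdot> x)) = c \<cdot> x + form c x *s c"
  proof (rule eq_by_functionals)
    fix f assume f: "Vector_Spaces.linear scale ((*) :: 'f \<Rightarrow> _) f"
    show "f (2 *s (c \<cdot> (c \<cdot> x))) = f (c \<cdot> x + form c x *s c)"
      using k unfolding cx mult_simps cc xh functional_simps[OF f] by algebra
  qed
qed

text \<open>The fusion rules make \<open>c\<close> and A_0(c) the even part and A_{1/2}(c) the odd
  part of a Z/2-grading, and the law expresses that changing the sign of the odd part is
  multiplicative. The proof expands both sides in components.\<close>

lemma axis_tau_law:
  assumes "axis c"
  shows "tau_law c"
  unfolding tau_law_def
proof (intro allI)
  fix x y
  define k :: 'f where "k = 1/2"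
  have k: "2 * k = 1" using two_neq_0 by (simp add: k_def)
  obtain x0 xh where x: "c \<cdot> x0 = 0" "c \<cdot> xh = k *s xh" "x = form c x *s c + x0 + xh"
    unfolding k_def using axis_decomp[OF assms] by metis
  obtain y0 yh where y: "c \<cdot> y0 = 0" "c \<cdot> yh = k *s yh" "y = form c y *s c + y0 + yh"
    unfolding k_def using axis_decomp[OF assms] by metis
  have cc: "c \<cdot> c = c" "form c c = 1" using assms by (auto simp: axis_def)
  have fus: "x0 \<in> eigenspace c 0 \<Longrightarrow> y0 \<in> eigenspace c 0 \<Longrightarrow> x0 \<cdot> y0 \<in> eigenspace c 0"
    "x0 \<in> eigenspace c 0 \<Longrightarrow> yh \<in> eigenspace c (1/2) \<Longrightarrow> x0 \<cdot> yh \<in> eigenspace c (1/2)"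
    "y0 \<in> eigenspace c 0 \<Longrightarrow> xh \<in> eigenspace c (1/2) \<Longrightarrow> y0 \<cdot> xh \<in> eigenspace c (1/2)"
    "xh \<in> eigenspace c (1/2) \<Longrightarrow> yh \<in> eigenspace c (1/2) \<Longrightarrow>
       \<exists>u \<in> span {c}. \<exists>z0 \<in> eigenspace c 0. xh \<cdot> yh = u + z0"
    using assms unfolding axis_def by blast+
  have mem: "x0 \<in> eigenspace c 0" "y0 \<in> eigenspace c 0" "xh \<in> eigenspace c (1/2)"
    "yh \<in> eigenspace c (1/2)"
    using x(1,2) y(1,2) by (auto simp: eigenspace_def k_def)
  have p: "c \<cdot> (x0 \<cdot> y0) = 0" "c \<cdot> (x0 \<cdot> yh) = k *s (x0 \<cdot> yh)" "c \<cdot> (xh \<cdot> y0) = k *s (xh \<cdot> y0)"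
    using fus mem by (auto simp: eigenspace_def k_def mult_commute[of xh y0])
  obtain m r where r: "xh \<cdot> yh = m *s c + r" "c \<cdot> r = 0"
    using fus(4) mem by (fastforce simp: span_singleton eigenspace_def)
  have xc: "x0 \<cdot> c = 0" "xh \<cdot> c = k *s xh" using x(1,2) by (auto simp: mult_commute[of _ c])
  have cx: "c \<cdot> x = form c x *s c + k *s xh"
    by (subst x(3)) (simp add: mult_simps cc x(1,2))
  have cy: "c \<cdot> y = form c y *s c + k *s yh"
    by (subst y(3)) (simp add: mult_simps cc y(1,2))
  have f0: "form c (c \<cdot> z) = form c z" for z
    using form_assoc[of c c z] cc by simp
  define \<xi> \<eta> where "\<xi> = form c x" and "\<eta> = form c y"
  have xy: "x = \<xi> *s c + x0 + xh" "y = \<eta> *s c + y0 + yh"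
    using x(3) y(3) by (simp_all add: \<xi>_def \<eta>_def)
  have prod: "x \<cdot> y = (\<xi> * \<eta> + m) *s c + (k * \<xi>) *s yh + x0 \<cdot> y0 + x0 \<cdot> yh + (\<eta> * k) *s xh
      + xh \<cdot> y0 + r"
    unfolding xy mult_simps xc r cc y
    by (simp add: algebra_simps)
  have cprod: "c \<cdot> (x \<cdot> y) = (\<xi> * \<eta> + m) *s c + (k * k * \<xi>) *s yh + k *s (x0 \<cdot> yh) + (\<eta> * k * k) *s xh
      + k *s (xh \<cdot> y0)"
    unfolding prod mult_simps cc p r x(1,2) y(1,2) by (simp add: algebra_simps)
  \<comment> \<open>Multiplying by \<open>c\<close> leaves the pairing with \<open>c\<close>
    unchanged and kills the A_0(c) terms; the remaining A_{1/2}(c) terms are orthogonal to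
    \<open>c\<close>.\<close>
  have "form c (x \<cdot> y) = form c (c \<cdot> (x \<cdot> y))" by (simp add: f0)
  also have "\<dots> = \<xi> * \<eta> + m"
  proof -
    have h: "(1::'f) \<noteq> k" using k two_neq_1 by auto
    have "form c z = 0" if "c \<cdot> z = k *s z" for z
      using orthogonal_eigenvectors[OF _ that, of c 1] cc h by simp
    then show ?thesis unfolding cprod by (simp add: form_simps cc p x(1,2) y(1,2))
  qed
  finally have fxy: "form c (x \<cdot> y) = \<xi> * \<eta> + m" .
  show "4 *s ((c \<cdot> x) \<cdot> (c \<cdot> y)) + c \<cdot> (x \<cdot> y) =
     x \<cdot> (c \<cdot> y) + (c \<cdot> x) \<cdot> y + form c y *s (c \<cdot> x) + form c x *s (c \<cdot> y) + form c (x \<cdot> y) *s c"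
  proof (rule eq_by_functionals)
    fix f assume f: "Vector_Spaces.linear scale ((*) :: 'f \<Rightarrow> _) f"
    show "f (4 *s ((c \<cdot> x) \<cdot> (c \<cdot> y)) + c \<cdot> (x \<cdot> y)) = f (x \<cdot> (c \<cdot> y) + (c \<cdot> x) \<cdot> y
        + form c y *s (c \<cdot> x) + form c x *s (c \<cdot> y) + form c (x \<cdot> y) *s c)"
      unfolding fxy cprod
      unfolding cx cy \<xi>_def[symmetric] \<eta>_def[symmetric]
      unfolding xy mult_simps cc x(1,2) y(1,2) xc r functional_simps[OF f]
      using k by algebra
  qed
qed

section \<open>The Miyamoto involution and transport of the laws\<close>

text \<open>For an axis this is the Miyamoto involution: identity on \<open>c\<close> and A_0(c),
  sign change on A_{1/2}(c). The closed formula can be handled without decomposing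
  \<open>x\<close>.\<close>

definition tau :: "'a \<Rightarrow> 'a \<Rightarrow> 'a" where
  "tau c x = x - 4 *s (c \<cdot> x) + (4 * form c x) *s c"

lemma tau_simps: "tau c (x + y) = tau c x + tau c y" "tau c (k *s x) = k *s tau c x"
  by (auto simp: tau_def mult_simps form_simps algebra_simps)

text \<open>In the expanded right-hand side, \<open>sq_law\<close> removes the double
  multiplications by \<open>c\<close>, and \<open>tau_law\<close> rewrites the remaining product of
  \<open>c \<cdot> x\<close> and \<open>c \<cdot> y\<close>.\<close>

lemma tau_mult:
  assumes "c \<cdot> c = c" "sq_law c" "tau_law c"
  shows "tau c (x \<cdot> y) = tau c x \<cdot> tau c y"
proof (rule eq_by_functionals)
  fix f assume f: "Vector_Spaces.linear scale ((*) :: 'f \<Rightarrow> _) f"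
  have sq: "f (2 *s (c \<cdot> (c \<cdot> z))) = f (c \<cdot> z + form c z *s c)" for z
    using assms(2) by (simp add: sq_law_def)
  have t: "f (4 *s ((c \<cdot> x) \<cdot> (c \<cdot> y)) + c \<cdot> (x \<cdot> y)) =
     f (x \<cdot> (c \<cdot> y) + (c \<cdot> x) \<cdot> y + form c y *s (c \<cdot> x) + form c x *s (c \<cdot> y) + form c (x \<cdot> y) *s c)"
    using assms(3) by (simp add: tau_law_def)
  have cm: "(c \<cdot> z) \<cdot> c = c \<cdot> (c \<cdot> z)" "x \<cdot> c = c \<cdot> x" for z
    by (simp_all add: mult_commute[of _ c])
  show "f (tau c (x \<cdot> y)) = f (tau c x \<cdot> tau c y)"
    using sq[of x] sq[of y] t
    unfolding tau_def mult_simps cm assms(1) functional_simps[OF f] by algebra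
qed

lemma tau_tau:
  assumes "c \<cdot> c = c" "form c c = 1" "sq_law c"
  shows "tau c (tau c x) = x"
proof (rule eq_by_functionals)
  fix f assume f: "Vector_Spaces.linear scale ((*) :: 'f \<Rightarrow> _) f"
  have sq: "f (2 *s (c \<cdot> (c \<cdot> z))) = f (c \<cdot> z + form c z *s c)" for z
    using assms(3) by (simp add: sq_law_def)
  have f0: "form c (c \<cdot> z) = form c z" for z
    using form_assoc[of c c z] assms by simp
  show "f (tau c (tau c x)) = f x"
    using sq[of x]
    unfolding tau_def mult_simps form_simps f0 assms(1,2) functional_simps[OF f] by algebra
qed

lemma tau_form:
  assumes "c \<cdot> c = c" "form c c = 1" "sq_law c"
  shows "form (tau c x) (tau c y) = form x y"
proof -
  have f0: "form c (c \<cdot> z) = form c z" for z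
    using form_assoc[of c c z] assms by simp
  have f1: "form (c \<cdot> z) c = form c z" for z
    unfolding form_commute[of "c \<cdot> z" c] by (rule f0)
  have "2 * form (c \<cdot> x) (c \<cdot> y) = form (2 *s (c \<cdot> (c \<cdot> x))) y"
    by (simp add: form_simps form_assoc[of "c \<cdot> x" c y, symmetric] mult_commute[of "c \<cdot> x" c])
  also have "\<dots> = form (c \<cdot> x) y + form c x * form c y"
    using assms(3) by (simp add: form_simps sq_law_def)
  finally have *: "2 * form (c \<cdot> x) (c \<cdot> y) = form (c \<cdot> x) y + form c x * form c y" .
  have **: "form x (c \<cdot> y) = form (c \<cdot> x) y" "form x c = form c x"
    by (metis form_assoc mult_commute, rule form_commute)
  show ?thesis using * unfolding tau_def form_simps f0 f1 ** assms(1,2) by algebra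
qed

text \<open>Both laws involve only the product and the form, and \<open>tau c\<close> is an
  isometric automorphism of order dividing 2. So the law for \<open>d\<close> at
  \<open>tau c x\<close>, \<open>tau c y\<close> is carried by \<open>tau c\<close> to the law for
  the image of \<open>d\<close> at \<open>x\<close>, \<open>y\<close>.\<close>

lemma tau_transport:
  assumes c: "c \<cdot> c = c" "form c c = 1" "sq_law c" "tau_law c"
    and d: "sq_law d" "tau_law d"
  shows "sq_law (tau c d)" "tau_law (tau c d)"
proof -
  note tm = tau_mult[OF c(1,3,4), symmetric] and tf = tau_form[OF c(1-3)]
  note tt = tau_tau[OF c(1-3)]
  show "sq_law (tau c d)"
    unfolding sq_law_def
  proof
    fix x
    have "tau c (2 *s (d \<cdot> (d \<cdot> tau c x))) = tau c (d \<cdot> tau c x + form d (tau c x) *s d)"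
      using d(1) by (simp add: sq_law_def)
    moreover have "form d (tau c x) = form (tau c d) x" using tf[of d "tau c x"] tt by simp
    ultimately show "2 *s (tau c d \<cdot> (tau c d \<cdot> x)) = tau c d \<cdot> x + form (tau c d) x *s tau c d"
      by (simp add: tau_simps tau_mult[OF c(1,3,4)] tt)
  qed
  show "tau_law (tau c d)"
    unfolding tau_law_def
  proof (intro allI)
    fix x y
    let ?x = "tau c x" and ?y = "tau c y"
    have "tau c (4 *s ((d \<cdot> ?x) \<cdot> (d \<cdot> ?y)) + d \<cdot> (?x \<cdot> ?y)) = tau c (?x \<cdot> (d \<cdot> ?y) + (d \<cdot> ?x) \<cdot> ?y
      + form d ?y *s (d \<cdot> ?x) + form d ?x *s (d \<cdot> ?y) + form d (?x \<cdot> ?y) *s d)"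
      using d(2) by (simp add: tau_law_def)
    moreover have fd: "form d (tau c z) = form (tau c d) z" for z using tf[of d "tau c z"] tt by simp
    moreover have "form d (?x \<cdot> ?y) = form (tau c d) (x \<cdot> y)" unfolding tm by (rule fd)
    ultimately show "4 *s ((tau c d \<cdot> x) \<cdot> (tau c d \<cdot> y)) + tau c d \<cdot> (x \<cdot> y) = x \<cdot> (tau c d \<cdot> y)
      + (tau c d \<cdot> x) \<cdot> y + form (tau c d) y *s (tau c d \<cdot> x) + form (tau c d) x *s (tau c d \<cdot> y)
      + form (tau c d) (x \<cdot> y) *s tau c d"
      by (simp add: tau_simps tau_mult[OF c(1,3,4)] tt)
  qed
qed

section \<open>Laws in components\<close>

lemma axis_fusion:
  assumes "axis c" "c \<cdot> x = 0"
  shows "c \<cdot> y = 0 \<Longrightarrow> c \<cdot> (x \<cdot> y) = 0"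
    and "c \<cdot> y = (1/2) *s y \<Longrightarrow> c \<cdot> (x \<cdot> y) = (1/2) *s (x \<cdot> y)"
proof -
  have "\<forall>x0 \<in> eigenspace c 0. \<forall>y0 \<in> eigenspace c 0. x0 \<cdot> y0 \<in> eigenspace c 0"
    "\<forall>x0 \<in> eigenspace c 0. \<forall>yh \<in> eigenspace c (1/2). x0 \<cdot> yh \<in> eigenspace c (1/2)"
    using assms(1) unfolding axis_def by blast+
  then show "c \<cdot> y = 0 \<Longrightarrow> c \<cdot> (x \<cdot> y) = 0"
    "c \<cdot> y = (1/2) *s y \<Longrightarrow> c \<cdot> (x \<cdot> y) = (1/2) *s (x \<cdot> y)"
    using assms(2) by (auto simp: eigenspace_def)
qed

lemma tau_decomp:
  assumes "c \<cdot> c = c" "form c c = 1" "c \<cdot> e = 0" "c \<cdot> s = (1/2) *s s"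
  shows "tau c (k *s c + e + s) = k *s c + e - s"
proof (rule eq_by_functionals)
  fix f assume f: "Vector_Spaces.linear scale ((*) :: 'f \<Rightarrow> _) f"
  define h :: 'f where "h = 1/2"
  have h: "2 * h = 1" using two_neq_0 by (simp add: h_def)
  have c: "c \<cdot> s = h *s s" using assms by (simp add: h_def)
  have "1 \<noteq> h" using h two_neq_1 by auto
  then have o: "form c e = 0" "form c s = 0"
    using orthogonal_eigenvectors[of c c 1 e 0] orthogonal_eigenvectors[of c c 1 s h]
      assms(1-3) c by auto
  show "f (tau c (k *s c + e + s)) = f (k *s c + e - s)"
    unfolding tau_def mult_simps form_simps assms(1-3) c o functional_simps[OF f]
    using h by algebra
qed

text \<open>The two laws differ by the sign of \<open>s\<close>, so subtracting them leaves twice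
  the terms odd in \<open>s\<close>. Terms pairing \<open>c\<close> or \<open>s\<close> with
  \<open>x\<close>, \<open>y\<close> or their product vanish by orthogonality.\<close>

lemma half_component_tau_law:
  assumes "tau_law (k *s c + e + s)" "tau_law (k *s c + e - s)"
    and "form c c = 1" "c \<cdot> c = c" "c \<cdot> s = (1/2) *s s" "c \<cdot> x = 0" "c \<cdot> y = 0" "c \<cdot> (x \<cdot> y) = 0"
  shows "4 *s ((e \<cdot> x) \<cdot> (s \<cdot> y) + (s \<cdot> x) \<cdot> (e \<cdot> y)) + s \<cdot> (x \<cdot> y) =
    x \<cdot> (s \<cdot> y) + (s \<cdot> x) \<cdot> y + form e y *s (s \<cdot> x) + form e x *s (s \<cdot> y) + form e (x \<cdot> y) *s s"
proof (rule eq_by_functionals)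
  fix f assume f: "Vector_Spaces.linear scale ((*) :: 'f \<Rightarrow> _) f"
  have c0: "form c z = 0" "form s z = 0" if "c \<cdot> z = 0" for z
    using orthogonal_eigenvectors[of c c 1 z 0] orthogonal_eigenvectors[of c s "1/2" z 0]
      that assms(4,5) two_neq_0 by auto
  note c0 = c0[OF assms(6)] c0[OF assms(7)] c0[OF assms(8)]
  have t: "f (4 *s ((d \<cdot> x) \<cdot> (d \<cdot> y)) + d \<cdot> (x \<cdot> y)) =
     f (x \<cdot> (d \<cdot> y) + (d \<cdot> x) \<cdot> y + form d y *s (d \<cdot> x) + form d x *s (d \<cdot> y) + form d (x \<cdot> y) *s d)"
    if "tau_law d" for d
    using that by (simp add: tau_law_def)
  let ?L = "4 *s ((e \<cdot> x) \<cdot> (s \<cdot> y) + (s \<cdot> x) \<cdot> (e \<cdot> y)) + s \<cdot> (x \<cdot> y)"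
  let ?R = "x \<cdot> (s \<cdot> y) + (s \<cdot> x) \<cdot> y + form e y *s (s \<cdot> x) + form e x *s (s \<cdot> y)
    + form e (x \<cdot> y) *s s"
  have "2 * f ?L = 2 * f ?R"
    using t[OF assms(1)] t[OF assms(2)]
    unfolding mult_simps form_simps assms(6-8) c0 functional_simps[OF f] by algebra
  then show "f ?L = f ?R" using two_neq_0 by simp
qed

section \<open>The case \<alpha> = 1/2\<close>

text \<open>Here the image of \<open>a\<close> under the involution of \<open>b\<close> has no
  A_{1/2}(a) component, so comparing two versions of the identity gives nothing. Instead, the
  products of \<open>e\<close> and \<open>s\<close> with elements of A_0(a) are computed
  explicitly.\<close>

lemma peirce_half:
  assumes a: "axis a" and b: "axis b" and ab: "form a b = 1/2"
    and e: "a \<cdot> e = 0" and s: "a \<cdot> s = (1/2) *s s" and bd: "b = form a b *s a + e + s"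
    and x: "a \<cdot> x = 0" and y: "a \<cdot> y = 0"
  shows "s \<cdot> (x \<cdot> y) = x \<cdot> (s \<cdot> y) + (s \<cdot> x) \<cdot> y"
proof -
  define k :: 'f where "k = 1/2"
  have k: "2 * k = 1" using two_neq_0 by (simp add: k_def)
  have cancel: "u = v" if "2 ^ 4 * u = 2 ^ 4 * v" for u v :: 'f
    using that power_not_zero[OF two_neq_0, of 4] mult_left_cancel by blast
    \<comment> \<open>\<open>algebra\<close> only finds integral certificates, so the denominators have to be cleared first.\<close>
  have aa: "a \<cdot> a = a" "form a a = 1" and bb: "b \<cdot> b = b" "form b b = 1"
    using a b by (auto simp: axis_def)
  have as: "a \<cdot> s = k *s s" using s by (simp add: k_def)
  have bd: "b = k *s a + e + s" using bd ab by (simp add: k_def)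
  define b' where "b' = k *s a + e - s"
  have b': "b' = tau a b"
    unfolding b'_def bd using tau_decomp[OF aa e s] by simp
  have laws: "sq_law b" "tau_law b" "sq_law b'" "tau_law b'"
    using axis_sq_law[OF b] axis_tau_law[OF b]
      tau_transport[OF aa axis_sq_law[OF a] axis_tau_law[OF a], of b] b' by auto
  have bb': "b' \<cdot> b' = b'"
    using tau_mult[OF aa(1) axis_sq_law[OF a] axis_tau_law[OF a], of b b] bb b' by simp
  have sa: "s \<cdot> a = k *s s" "e \<cdot> a = 0"
    using as e by (simp_all add: mult_commute[of s a] mult_commute[of e a])
  have ba: "b \<cdot> a = k *s a + k *s s"
    unfolding bd by (simp add: mult_simps aa sa)
  have ba2: "form b a = k" using ab by (simp add: k_def form_commute)
  \<comment> \<open>By definition the image is a - 2(a + s) + 2b, where b = a/2 + e + s.\<close>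
  have c: "tau b a = 2 *s e"
  proof (rule eq_by_functionals)
    fix f assume f: "Vector_Spaces.linear scale ((*) :: 'f \<Rightarrow> _) f"
    show "f (tau b a) = f (2 *s e)"
      unfolding tau_def ba ba2 using k unfolding bd functional_simps[OF f] by algebra
  qed
  have claw: "sq_law (2 *s e)"
    using tau_transport(1)[OF bb axis_sq_law[OF b] axis_tau_law[OF b] axis_sq_law[OF a]
      axis_tau_law[OF a]] c by simp
  have cc: "(2 *s e) \<cdot> (2 *s e) = 2 *s e"
    using tau_mult[OF bb(1) axis_sq_law[OF b] axis_tau_law[OF b], of a a] aa c by simp
  have ee: "e \<cdot> e = k *s e"
  proof (rule eq_by_functionals)
    fix f assume f: "Vector_Spaces.linear scale ((*) :: 'f \<Rightarrow> _) f"
    show "f (e \<cdot> e) = f (k *s e)"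
      using k arg_cong[OF cc, of f] unfolding mult_simps functional_simps[OF f] by (rule_tac cancel) algebra
  qed
  \<comment> \<open>The idempotents \<open>b\<close> and \<open>b'\<close> differ by the sign of
    \<open>s\<close>: the difference of their equations determines \<open>e \<cdot> s\<close>, and
    their sum determines \<open>s \<cdot> s\<close> below.\<close>
  have es: "e \<cdot> s = (k * k) *s s"
  proof (rule eq_by_functionals)
    fix f assume f: "Vector_Spaces.linear scale ((*) :: 'f \<Rightarrow> _) f"
    show "f (e \<cdot> s) = f ((k * k) *s s)"
      using k arg_cong[OF bb(1), of f] arg_cong[OF bb', of f]
      unfolding bd b'_def mult_simps as sa e aa mult_commute[of s e] functional_simps[OF f]
      by (rule_tac cancel) algebra
  qed
  have se: "s \<cdot> e = (k * k) *s s" using es by (simp add: mult_commute)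
  have ss: "s \<cdot> s = (k * k) *s a + k *s e"
  proof (rule eq_by_functionals)
    fix f assume f: "Vector_Spaces.linear scale ((*) :: 'f \<Rightarrow> _) f"
    show "f (s \<cdot> s) = f ((k * k) *s a + k *s e)"
      using k arg_cong[OF bb(1), of f] arg_cong[OF bb', of f]
      unfolding bd b'_def mult_simps as sa e aa se es ee functional_simps[OF f]
      by (rule_tac cancel) algebra
  qed
  have fus0: "a \<cdot> (u \<cdot> v) = 0" if "a \<cdot> u = 0" "a \<cdot> v = 0" for u v
    using axis_fusion(1)[OF a] that by simp
  have fush: "a \<cdot> (u \<cdot> v) = k *s (u \<cdot> v)" "a \<cdot> (v \<cdot> u) = k *s (v \<cdot> u)"
    if "a \<cdot> u = 0" "a \<cdot> v = k *s v" for u v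
    using axis_fusion(2)[OF a that(1)] that(2) mult_commute[of v u] by (simp_all add: k_def)
  have k01: "k \<noteq> 0" "1 \<noteq> k" using k two_neq_1 by auto
  have fa0: "form a u = 0" "form s u = 0" if "a \<cdot> u = 0" for u
    using orthogonal_eigenvectors[of a a 1 u 0] orthogonal_eigenvectors[of a s k u 0]
      that aa as k01 by auto
  have fh: "form a u = 0" "form e u = 0" if "a \<cdot> u = k *s u" for u
    using orthogonal_eigenvectors[of a a 1 u k] orthogonal_eigenvectors[of a e 0 u k]
      that aa e k01 by auto
  have sq: "f (2 *s (d \<cdot> (d \<cdot> z))) = f (d \<cdot> z + form d z *s d)"
    if "sq_law d" for d z and f :: "'a \<Rightarrow> 'f"
    using that by (simp add: sq_law_def)
  \<comment> \<open>In \<open>sq_law\<close> for \<open>b\<close> and \<open>b'\<close>, the part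
    even in \<open>s\<close>, together with \<open>sq_law\<close> for 2e, gives the third formula.
    The odd part gives only the sum of the first two products; the identity \<open>two\<close>, for
    the pair \<open>x\<close>, \<open>e\<close>, separates them.\<close>
  have es_x: "e \<cdot> (s \<cdot> x) = (k * k * form e x) *s s"
    and se_x: "s \<cdot> (e \<cdot> x) = (k * k) *s (s \<cdot> x) + (k * k * form e x) *s s"
    and ss_x: "s \<cdot> (s \<cdot> x) = (k * k) *s (e \<cdot> x) + (k * k * form e x) *s a"
    if x: "a \<cdot> x = 0" for x
  proof -
    note ax = x fush[OF x as] fus0[OF e x] fa0[OF x]
    have fexe: "form e (x \<cdot> e) = k * form e x"
      using form_assoc[of e e x] ee by (simp add: form_simps mult_commute[of x e])
    have two: "4 *s ((e \<cdot> x) \<cdot> (s \<cdot> e) + (s \<cdot> x) \<cdot> (e \<cdot> e)) + s \<cdot> (x \<cdot> e) =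
      x \<cdot> (s \<cdot> e) + (s \<cdot> x) \<cdot> e + form e e *s (s \<cdot> x) + form e x *s (s \<cdot> e) + form e (x \<cdot> e) *s s"
      using half_component_tau_law[OF _ _ aa(2,1) s x e fus0[OF x e]] laws unfolding bd b'_def
      by blast
    \<comment> \<open>The summands of \<open>b\<close> are mutually orthogonal, so (b,b) = 1 yields
      (e,e) once (s,s) = 1/2 is known from (as,s) = (a,ss).\<close>
    have fee: "form e e = k * k"
    proof -
      have "form b b = k * k + form e e + form s s"
        unfolding bd form_simps aa fa0[OF e] fh[OF as] form_commute[of e a] form_commute[of s a]
          form_commute[of e s] by simp
      moreover have "form s s = k"
        using form_assoc[of a s s] fa0[OF e] k01(1) by (simp add: as ss form_simps aa)
      ultimately show ?thesis using bb(2) k by (rule_tac cancel) algebra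
    qed
    have eq: "f (e \<cdot> (s \<cdot> x)) = f ((k * k * form e x) *s s)
      \<and> f (s \<cdot> (e \<cdot> x)) = f ((k * k) *s (s \<cdot> x) + (k * k * form e x) *s s)
      \<and> f (s \<cdot> (s \<cdot> x)) = f ((k * k) *s (e \<cdot> x) + (k * k * form e x) *s a)"
      if f: "Vector_Spaces.linear scale ((*) :: 'f \<Rightarrow> _) f" for f
    proof -
      have sqb: "f (2 *s (b \<cdot> (b \<cdot> x))) = f (b \<cdot> x + form b x *s b)"
        "f (2 *s (b' \<cdot> (b' \<cdot> x))) = f (b' \<cdot> x + form b' x *s b')"
        "f (2 *s ((2 *s e) \<cdot> ((2 *s e) \<cdot> x))) = f ((2 *s e) \<cdot> x + form (2 *s e) x *s (2 *s e))"
        using sq laws claw by blast+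
      note sqb = sqb[unfolded bd b'_def mult_simps form_simps ax functional_simps[OF f]]
      note two = arg_cong[OF two, of f, unfolded mult_commute[of x e] mult_commute[of x s]
          mult_commute[of "e \<cdot> x" s] mult_commute[of "s \<cdot> x" e] fexe[unfolded mult_commute[of x e]]
          fee se ee mult_simps]
      have "f (e \<cdot> (s \<cdot> x)) = f ((k * k * form e x) *s s)"
        using sqb k two unfolding mult_commute[of x s]
          mult_commute[of "e \<cdot> x" s] mult_commute[of "s \<cdot> x" e] functional_simps[OF f] by (rule_tac cancel) algebra
      moreover have "f (s \<cdot> (s \<cdot> x)) = f ((k * k) *s (e \<cdot> x) + (k * k * form e x) *s a)"
        using sqb k unfolding functional_simps[OF f] by (rule_tac cancel) algebra
      moreover have "f (s \<cdot> (e \<cdot> x)) = f ((k * k) *s (s \<cdot> x) + (k * k * form e x) *s s)"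
        using sqb k calculation(1) unfolding functional_simps[OF f] by (rule_tac cancel) algebra
      ultimately show ?thesis by blast
    qed
    show "e \<cdot> (s \<cdot> x) = (k * k * form e x) *s s"
      "s \<cdot> (e \<cdot> x) = (k * k) *s (s \<cdot> x) + (k * k * form e x) *s s"
      "s \<cdot> (s \<cdot> x) = (k * k) *s (e \<cdot> x) + (k * k * form e x) *s a"
      using eq by (intro eq_by_functionals; blast)+
  qed
  \<comment> \<open>This comes from adding \<open>tau_law\<close> for \<open>b\<close> and for
    \<open>b'\<close> on \<open>x\<close> and \<open>s \<cdot> y\<close>, which isolates the
    A_{1/2}(a) component. After inserting the formulas above, the terms (ex)(sy) and x(sy)/4
    cancel.\<close>
  have eH: "f (e \<cdot> (x \<cdot> (s \<cdot> y))) + f ((s \<cdot> x) \<cdot> (e \<cdot> y))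
      = k * k * (form e x * f (s \<cdot> y) + form e (x \<cdot> y) * f s)"
    if x: "a \<cdot> x = 0" and y: "a \<cdot> y = 0" and f: "Vector_Spaces.linear scale ((*) :: 'f \<Rightarrow> _) f" for x y f
  proof -
    note ax = x y as sa(1) fush[OF x as] fush[OF y as] fush[OF x fush(2)[OF y as]] fus0[OF e x] fus0[OF e y]
      fa0[OF x] fa0[OF y] fh[OF fush(2)[OF y as]] fh[OF fush(1)[OF x fush(2)[OF y as]]]
    have o: "form s (s \<cdot> y) = k * form e y"
      using form_assoc[of s s y] fa0[OF y] by (simp add: ss form_simps)
    have o2: "form s (x \<cdot> (s \<cdot> y)) = k * k * form e (x \<cdot> y)"
    proof -
      have "form s (x \<cdot> (s \<cdot> y)) = form (s \<cdot> (s \<cdot> x)) y"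
        by (metis form_assoc mult_commute)
      also have "\<dots> = k * k * form (e \<cdot> x) y"
        unfolding ss_x[OF x] form_simps fa0[OF y] by simp
      finally show ?thesis by (simp add: form_assoc)
    qed
    have sxa: "(s \<cdot> x) \<cdot> a = k *s (s \<cdot> x)" "(e \<cdot> x) \<cdot> s = s \<cdot> (e \<cdot> x)" "x \<cdot> s = s \<cdot> x" "x \<cdot> a = 0"
      "(e \<cdot> x) \<cdot> a = 0"
      using fush(2)[OF x as] fus0[OF e x] x
      by (simp_all add: mult_commute[of "s \<cdot> x" a] mult_commute[of "e \<cdot> x"] mult_commute[of x])
    have t: "f (4 *s ((d \<cdot> x) \<cdot> (d \<cdot> (s \<cdot> y))) + d \<cdot> (x \<cdot> (s \<cdot> y))) =
       f (x \<cdot> (d \<cdot> (s \<cdot> y)) + (d \<cdot> x) \<cdot> (s \<cdot> y) + form d (s \<cdot> y) *s (d \<cdot> x)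
         + form d x *s (d \<cdot> (s \<cdot> y)) + form d (x \<cdot> (s \<cdot> y)) *s d)"
      if "tau_law d" for d
      using that by (simp add: tau_law_def)
    note tt = t[OF laws(2)] t[OF laws(4)]
    note tt = tt[unfolded bd b'_def mult_simps form_simps ax o o2 es_x[OF y] ss_x[OF y]
        mult_simps sxa se_x[OF x] functional_simps[OF f]]
    show ?thesis
      using tt k by (rule_tac cancel) algebra
  qed
  define D where "D = x \<cdot> (s \<cdot> y) + (s \<cdot> x) \<cdot> y - s \<cdot> (x \<cdot> y)"
  have xy: "a \<cdot> (x \<cdot> y) = 0" using fus0[OF x y] .
  \<comment> \<open>Add \<open>eH\<close> for (x,y) and for (y,x). The identity \<open>two\<close>
    eliminates (ex)(sy) + (sx)(ey), and \<open>es_x\<close> at \<open>x \<cdot> y\<close> supplies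
    the remaining term e(s(xy)).\<close>
  have eD: "e \<cdot> D = (- (k * k)) *s D"
  proof (rule eq_by_functionals)
    fix f assume f: "Vector_Spaces.linear scale ((*) :: 'f \<Rightarrow> _) f"
    have two: "4 *s ((e \<cdot> x) \<cdot> (s \<cdot> y) + (s \<cdot> x) \<cdot> (e \<cdot> y)) + s \<cdot> (x \<cdot> y) =
      x \<cdot> (s \<cdot> y) + (s \<cdot> x) \<cdot> y + form e y *s (s \<cdot> x) + form e x *s (s \<cdot> y) + form e (x \<cdot> y) *s s"
      using half_component_tau_law[OF _ _ aa(2,1) s x y xy] laws unfolding bd b'_def by blast
    note c = mult_commute[of "s \<cdot> x" y] mult_commute[of "e \<cdot> x" "s \<cdot> y"]
    show "f (e \<cdot> D) = f ((- (k * k)) *s D)"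
      using eH[OF x y f] eH[OF y x f] arg_cong[OF two, of f] k
      unfolding D_def mult_simps es_x[OF xy] functional_simps[OF f] c mult_commute[of y x]
      by (rule_tac cancel) algebra
  qed
  have "a \<cdot> D = k *s D"
    unfolding D_def mult_simps using fush(2)[OF y as] fush(2)[OF x as] fush(2)[OF xy as]
      fush(1)[OF x fush(2)[OF y as]] fush(2)[OF y fush(2)[OF x as]]
    by (simp add: scale_right_distrib scale_right_diff_distrib)
  then have eD0: "form e D = 0" by (rule fh(2))
  have "D = 0"
  proof (rule eq_by_functionals)
    fix f assume f: "Vector_Spaces.linear scale ((*) :: 'f \<Rightarrow> _) f"
    \<comment> \<open>2e acts on \<open>D\<close> as -1/2, which is not a root of 2t^2 = t; with
      (e,D) = 0 the law reads D/2 = -D/2.\<close>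
    have "f (2 *s ((2 *s e) \<cdot> ((2 *s e) \<cdot> D))) = f ((2 *s e) \<cdot> D + form (2 *s e) D *s (2 *s e))"
      using sq[OF claw] .
    then show "f D = f 0"
      using k unfolding mult_simps eD form_simps eD0 functional_simps[OF f]
      by (rule_tac cancel) algebra
  qed
  then show ?thesis by (simp add: D_def)
qed

section \<open>The general case\<close>

lemma peirce:
  assumes a: "axis a" and b: "axis b" and ab: "form a b \<noteq> 1/4"
    and e: "a \<cdot> e = 0" and s: "a \<cdot> s = (1/2) *s s" and bd: "b = form a b *s a + e + s"
    and x: "a \<cdot> x = 0" and y: "a \<cdot> y = 0"
  shows "s \<cdot> (x \<cdot> y) = x \<cdot> (s \<cdot> y) + (s \<cdot> x) \<cdot> y"
proof (cases "form a b = 1/2")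
  case True
  then show ?thesis using peirce_half[OF a b _ e s bd x y] by simp
next
  case False
  define \<alpha> where "\<alpha> = form a b"
  define k :: 'f where "k = 1/2"
  have k: "2 * k = 1" using two_neq_0 by (simp add: k_def)
  have as: "a \<cdot> s = k *s s" using s by (simp add: k_def)
  have nz: "4 * \<alpha> - 2 \<noteq> 0" "4 * \<alpha> - 1 \<noteq> 0"
  proof -
    have four: "(4 :: 'f) \<noteq> 0" using power_not_zero[OF two_neq_0, of 2] by simp
    show "4 * \<alpha> - 1 \<noteq> 0"
      using ab four unfolding \<alpha>_def by (auto simp: field_simps)
    have "2 * \<alpha> - 1 \<noteq> 0"
      using False two_neq_0 unfolding \<alpha>_def by (auto simp: field_simps)
    moreover have "4 * \<alpha> - 2 = 2 * (2 * \<alpha> - 1)" by (simp add: algebra_simps)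
    ultimately show "4 * \<alpha> - 2 \<noteq> 0" using two_neq_0 by (metis mult_eq_0_iff)
  qed
  have aa: "a \<cdot> a = a" "form a a = 1" and bb: "b \<cdot> b = b" "form b b = 1"
    using a b by (auto simp: axis_def)
  have bd: "b = \<alpha> *s a + e + s" using bd by (simp add: \<alpha>_def)
  define b' where "b' = \<alpha> *s a + e - s"
  have b': "b' = tau a b"
    unfolding b'_def bd using tau_decomp[OF aa e s] by simp
  have laws: "tau_law b" "tau_law b'"
    using axis_tau_law[OF b]
      tau_transport[OF aa axis_sq_law[OF a] axis_tau_law[OF a], of b] axis_sq_law[OF b] b' by auto
  have sa: "s \<cdot> a = k *s s" "e \<cdot> a = 0"
    using as e by (simp_all add: mult_commute[of s a] mult_commute[of e a])
  have ba: "b \<cdot> a = \<alpha> *s a + k *s s"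
    unfolding bd by (simp add: mult_simps aa sa)
  have ba2: "form b a = \<alpha>" by (simp add: \<alpha>_def form_commute)
  \<comment> \<open>\<open>m\<close>, \<open>e'\<close> and \<open>s'\<close> are read off from a -
    4(\<alpha>a + s/2) + 4\<alpha>b, the image of \<open>a\<close> under the involution of
    \<open>b\<close>.\<close>
  define m where "m = 1 - 4 * \<alpha> + 4 * \<alpha> * \<alpha>"
  define e' where "e' = (4 * \<alpha>) *s e"
  define s' where "s' = (4 * \<alpha> - 2) *s s"
  have c: "tau b a = m *s a + e' + s'"
  proof (rule eq_by_functionals)
    fix f assume f: "Vector_Spaces.linear scale ((*) :: 'f \<Rightarrow> _) f"
    show "f (tau b a) = f (m *s a + e' + s')"
      unfolding tau_def ba ba2 m_def e'_def s'_def
      using k unfolding bd functional_simps[OF f] by algebra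
  qed
  have es': "a \<cdot> e' = 0" "a \<cdot> s' = (1/2) *s s'"
    unfolding e'_def s'_def mult_simps e s by (simp_all add: mult.commute)
  have claw: "sq_law (tau b a)" "tau_law (tau b a)"
    using tau_transport[OF bb axis_sq_law[OF b] axis_tau_law[OF b] axis_sq_law[OF a]
      axis_tau_law[OF a]] by simp_all
  have "tau a (tau b a) = m *s a + e' - s'"
    unfolding c by (rule tau_decomp[OF aa es'])
  then have claws: "tau_law (m *s a + e' + s')" "tau_law (m *s a + e' - s')"
    using tau_transport[OF aa axis_sq_law[OF a] axis_tau_law[OF a] claw] claw c by auto
  have xy: "a \<cdot> (x \<cdot> y) = 0" using axis_fusion(1)[OF a x y] .
  have two: "4 *s ((e \<cdot> x) \<cdot> (s \<cdot> y) + (s \<cdot> x) \<cdot> (e \<cdot> y)) + s \<cdot> (x \<cdot> y) =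
      x \<cdot> (s \<cdot> y) + (s \<cdot> x) \<cdot> y + form e y *s (s \<cdot> x) + form e x *s (s \<cdot> y) + form e (x \<cdot> y) *s s"
    using half_component_tau_law[OF _ _ aa(2,1) s x y xy] laws unfolding bd b'_def by blast
  note three = half_component_tau_law[OF claws aa(2,1) es'(2) x y xy]
  show ?thesis
  proof (rule eq_by_functionals)
    fix f assume f: "Vector_Spaces.linear scale ((*) :: 'f \<Rightarrow> _) f"
    \<comment> \<open>Passing from \<open>two\<close> to \<open>three\<close> scales the terms
      involving both \<open>e\<close> and \<open>s\<close> by 4\<alpha>(4\<alpha> - 2), but those
      involving \<open>s\<close> alone only by 4\<alpha> - 2. Subtracting 4\<alpha>(4\<alpha> - 2)
      times \<open>two\<close> therefore leaves only the latter.\<close>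
    have "(4 * \<alpha> - 2) * ((4 * \<alpha> - 1) * f (s \<cdot> (x \<cdot> y))) =
      (4 * \<alpha> - 2) * ((4 * \<alpha> - 1) * f (x \<cdot> (s \<cdot> y) + (s \<cdot> x) \<cdot> y))"
      using arg_cong[OF two, of f] arg_cong[OF three, of f]
      unfolding e'_def s'_def mult_simps form_simps functional_simps[OF f] by algebra
    then show "f (s \<cdot> (x \<cdot> y)) = f (x \<cdot> (s \<cdot> y) + (s \<cdot> x) \<cdot> y)"
      using nz by simp
  qed
qed

section \<open>Identification of the half component\<close>

text \<open>Multiplying any admissible decomposition of \<open>b\<close> by \<open>a\<close> forces
  its last summand to be 2(ab - (a,b)a). This gives the uniqueness that the definite description in
  \<open>half_part\<close> requires.\<close>

lemma half_part_decomp: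
  assumes "axis a"
  obtains e where "a \<cdot> e = 0" "a \<cdot> half_part a b = (1/2) *s half_part a b"
    "b = form a b *s a + e + half_part a b"
proof -
  obtain e s where *: "a \<cdot> e = 0" "a \<cdot> s = (1/2) *s s" "b = form a b *s a + e + s"
    using axis_decomp[OF assms] by metis
  have eq: "xh = 2 *s (a \<cdot> b - form a b *s a)"
    if xh: "a \<cdot> xh = (1/2) *s xh" and x0: "a \<cdot> x0 = 0" and "b = form a b *s a + x0 + xh" for xh x0
  proof -
    have "a \<cdot> a = a" using assms by (simp add: axis_def)
    then have "a \<cdot> b = form a b *s a + (1/2) *s xh"
      by (subst that(3)) (simp add: mult_simps xh x0)
    then show ?thesis using two_neq_0 by simp
  qed
  have "half_part a b = s"
    unfolding half_part_def
  proof (rule the_equality)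
    show "s \<in> eigenspace a (1/2) \<and> (\<exists>x0 \<in> eigenspace a 0. b = form a b *s a + x0 + s)"
      using * by (auto simp: eigenspace_def)
  next
    fix xh assume "xh \<in> eigenspace a (1/2) \<and> (\<exists>x0 \<in> eigenspace a 0. b = form a b *s a + x0 + xh)"
    then have "xh = 2 *s (a \<cdot> b - form a b *s a)" using eq by (auto simp: eigenspace_def)
    also have "\<dots> = s" using eq[OF *(2,1,3)] by simp
    finally show "xh = s" .
  qed
  with * that show thesis by metis
qed

end

theorem theorem1p3:
  fixes scale :: "'f::field \<Rightarrow> 'a::ab_group_add \<Rightarrow> 'a"
    and mult :: "'a \<Rightarrow> 'a \<Rightarrow> 'a"  (infixl "\<cdot>" 70)
    and form :: "'a \<Rightarrow> 'a \<Rightarrow> 'f"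
    and a b x0 y0 :: 'a
  assumes "frobenius_algebra scale mult form"
    and "frobenius_algebra.axis scale mult form a"
    and "frobenius_algebra.axis scale mult form b"
    and "form a b \<noteq> 1/4"
    and "x0 \<in> frobenius_algebra.eigenspace scale mult a 0"
    and "y0 \<in> frobenius_algebra.eigenspace scale mult a 0"
  shows "let bh = frobenius_algebra.half_part scale mult form a b in
    bh \<cdot> (x0 \<cdot> y0) = (bh \<cdot> x0) \<cdot> y0 + (bh \<cdot> y0) \<cdot> x0"
proof -
  interpret frobenius_algebra scale mult form by fact
  obtain e where e: "a \<cdot> e = 0" "a \<cdot> half_part a b = scale (1/2) (half_part a b)"
    "b = scale (form a b) a + e + half_part a b"
    using half_part_decomp[OF assms(2)] .
  have "a \<cdot> x0 = 0" "a \<cdot> y0 = 0" using assms(5,6) by (simp_all add: eigenspace_def)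
  from peirce[OF assms(2-4) e this] show ?thesis
    unfolding Let_def mult_commute[of "half_part a b \<cdot> y0" x0] by (simp add: add.commute)
qed

end
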